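(* Let $G$ be a finite group and let $\Gamma$ be the subgroup of $G$ generated by all elements of $G$ whose orders are powers of $2$. Then $\Gamma$ is a normal subgroup of $G$, $|G/\Gamma|$ is odd, and $f(G)=f(G/\Gamma)\,|\Gamma|$.
   Context: Explorer-Director game on a finite group $G$: a token starts at some given element $s\in G$ (which counts as visited). The game has perfect information and is played in rounds, with no limit on the number of rounds. In each round, if the token is at $x$, Explorer names an element $g\in G$, and then Director moves the token to either $xg$ or $xg^{-1}$, as Director chooses. Explorer wants to maximize, and Director to minimize, the number of distinct elements of $G$ ever visited by the token. $f(G)$ denotes the number of elements visited under optimal play, i.e. the largest $k$ such that Explorer has a strategy guaranteeing that at least $k$ distinct elements are visited; by left translation it does not depend on $s$. The same definition applies to the finite group $G/\Gamma$. *)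

theory Defs
  imports "HOL-Algebra.Algebra"
begin

text \<open>
  A play of the Explorer-Director game is the infinite sequence of token positions, so that
  ``visited'' means in the range of that sequence. An Explorer strategy maps the history,
  i.e. the nonempty list of all positions so far with the current one last, to the element to
  be named. Once the strategy is fixed, its earlier outputs are determined by the prefixes of
  this list, so nothing is lost by not recording the named elements separately.
\<close>

definition explorer_strategy :: "('a, 'b) monoid_scheme \<Rightarrow> ('a list \<Rightarrow> 'a) \<Rightarrow> bool" where
  "explorer_strategy G \<sigma> \<longleftrightarrow> (\<forall>h. \<sigma> h \<in> carrier G)"

definition play_against ::
    "('a, 'b) monoid_scheme \<Rightarrow> 'a \<Rightarrow> ('a list \<Rightarrow> 'a) \<Rightarrow> (nat \<Rightarrow> 'a) \<Rightarrow> bool" where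
  "play_against G s \<sigma> p \<longleftrightarrow>
     p 0 = s \<and>
     (\<forall>n. let g = \<sigma> (map p [0..<Suc n])
          in p (Suc n) = p n \<otimes>\<^bsub>G\<^esub> g \<or> p (Suc n) = p n \<otimes>\<^bsub>G\<^esub> inv\<^bsub>G\<^esub> g)"

text \<open>
  Director's (possibly adaptive) behaviour is accounted for by quantifying over all plays that
  are compatible with Explorer's strategy.
\<close>

definition explorer_guarantees :: "('a, 'b) monoid_scheme \<Rightarrow> 'a \<Rightarrow> nat \<Rightarrow> bool" where
  "explorer_guarantees G s k \<longleftrightarrow>
     (\<exists>\<sigma>. explorer_strategy G \<sigma> \<and> (\<forall>p. play_against G s \<sigma> p \<longrightarrow> k \<le> card (range p)))"

text \<open>
  For finite \<open>G\<close> and \<open>s \<in> carrier G\<close> the guaranteed numbers contain \<open>0\<close> and are bounded by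
  \<open>order G\<close>, so the greatest one exists. For infinite \<open>G\<close> this value is not meaningful.
\<close>

definition explorer_director :: "('a, 'b) monoid_scheme \<Rightarrow> 'a \<Rightarrow> nat" where
  "explorer_director G s = (GREATEST k. explorer_guarantees G s k)"

definition two_power_subgroup :: "('a, 'b) monoid_scheme \<Rightarrow> 'a set" where
  "two_power_subgroup G = generate G {x \<in> carrier G. \<exists>k. group.ord G x = 2 ^ k}"

end

theory Submission imports Defs begin

text \<open>
  An element \<open>c\<close> of order \<open>2 ^ k\<close> is a move that Director cannot refuse: if the token at \<open>x\<close> is
  sent to \<open>x c\<inverse>\<close> instead of \<open>x c\<close>, then the target is reached from the new position by the
  element \<open>c\<^sup>2\<close> of order \<open>2 ^ (k - 1)\<close>. Hence Explorer can walk at will inside a coset of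
  \<open>\<Gamma>\<close> and visit all of it, so a strategy for \<open>G / \<Gamma>\<close> that visits \<open>k\<close> cosets lifts to one
  for \<open>G\<close> that visits all elements of \<open>k\<close> cosets. Conversely the moves of any strategy on \<open>G\<close>
  project to moves on \<open>G / \<Gamma>\<close>, and at most \<open>|\<Gamma>|\<close> visited elements share a coset. The
  index of \<open>\<Gamma>\<close> is odd because \<open>\<Gamma>\<close> contains a Sylow 2-subgroup.
\<close>

section \<open>The reachability game on visited set and position\<close>

text \<open>
  Only the visited set \<open>W\<close> and the current position \<open>x\<close> matter for Explorer's prospects, so
  strategies on histories are replaced by an inductive reachability game on pairs \<open>(W, x)\<close>, in
  which Explorer tries to reach a state satisfying \<open>P\<close>.
\<close>

inductive can_force ::
    "('a, 'b) monoid_scheme \<Rightarrow> ('a set \<Rightarrow> 'a \<Rightarrow> bool) \<Rightarrow> 'a set \<Rightarrow> 'a \<Rightarrow> bool"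
  for G :: "('a, 'b) monoid_scheme" and P where
  goal: "P W x \<Longrightarrow> can_force G P W x"
| move: "g \<in> carrier G \<Longrightarrow>
    can_force G P (insert (x \<otimes>\<^bsub>G\<^esub> g) W) (x \<otimes>\<^bsub>G\<^esub> g) \<Longrightarrow>
    can_force G P (insert (x \<otimes>\<^bsub>G\<^esub> inv\<^bsub>G\<^esub> g) W) (x \<otimes>\<^bsub>G\<^esub> inv\<^bsub>G\<^esub> g) \<Longrightarrow>
    can_force G P W x"

text \<open>A state holds all of the past that matters, so play for \<open>P\<close> can be followed
  by play for \<open>Q\<close>. This composes the phases of Explorer's play.\<close>

lemma can_force_bind:
  assumes "can_force G P W x" "\<And>W' y. P W' y \<Longrightarrow> can_force G Q W' y"
  shows "can_force G Q W x"
  using assms(1)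
proof (induction rule: can_force.induct)
  case (goal W x)
  then show ?case by (rule assms(2))
next
  case (move g x W)
  show ?case by (rule can_force.move[OF move.hyps(1) move.IH])
qed

lemma can_force_mono:
  assumes "can_force G P W x" "\<And>W' y. P W' y \<Longrightarrow> Q W' y"
  shows "can_force G Q W x"
  using assms(1) by (rule can_force_bind) (rule can_force.goal, rule assms(2))

section \<open>Strategies on histories versus the reachability game\<close>

lemma play_against_shift:
  assumes "play_against G s \<sigma> p"
  shows "play_against G (p 1) (\<lambda>h. \<sigma> (s # h)) (p \<circ> Suc)"
proof -
  have "map p [0..<Suc (Suc n)] = s # map (p \<circ> Suc) [0..<Suc n]" for n
    using assms unfolding play_against_def
    by (subst map_upt_Suc) (simp add: comp_def)
  then show ?thesis
    using assms unfolding play_against_def Let_def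
    by (metis One_nat_def comp_apply)
qed

context group
begin

lemma play_in_carrier:
  assumes "explorer_strategy G \<sigma>" "play_against G s \<sigma> p" "s \<in> carrier G"
  shows "p n \<in> carrier G"
proof (induction n)
  case 0
  then show ?case using assms by (simp add: play_against_def)
next
  case (Suc n)
  then show ?case
    using assms unfolding play_against_def explorer_strategy_def Let_def
    by (metis inv_closed m_closed)
qed

text \<open>A derivation of \<open>can_force\<close> is a strategy tree without infinite branches;
  induction over it assembles a strategy on histories. Positions visited before reaching
  \<open>x\<close> count towards the goal, hence the union with \<open>W\<close>.\<close>

lemma strategy_of_can_force:
  assumes "can_force G (\<lambda>W _. k \<le> card W) W x"
    and "finite (carrier G)" "W \<subseteq> carrier G" "x \<in> carrier G"
  shows "\<exists>\<sigma>. explorer_strategy G \<sigma> \<and> (\<forall>p. play_against G x \<sigma> p \<longrightarrow> k \<le> card (W \<union> range p))"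
  using assms
proof (induction rule: can_force.induct)
  case (goal W x)
  let ?\<sigma> = "\<lambda>_. \<one>"
  have "explorer_strategy G ?\<sigma>"
    by (simp add: explorer_strategy_def)
  moreover have "k \<le> card (W \<union> range p)" if p: "play_against G x ?\<sigma> p" for p
  proof -
    have "W \<union> range p \<subseteq> carrier G"
      using play_in_carrier[OF \<open>explorer_strategy G ?\<sigma>\<close> p] goal by auto
    then have "card W \<le> card (W \<union> range p)"
      using goal by (meson Un_upper1 card_mono finite_subset)
    with goal show ?thesis by simp
  qed
  ultimately show ?case by blast
next
  case (move g x W)
  obtain \<sigma>1 where \<sigma>1: "explorer_strategy G \<sigma>1"
    "\<And>p. play_against G (x \<otimes> g) \<sigma>1 p \<Longrightarrow> k \<le> card (insert (x \<otimes> g) W \<union> range p)"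
    using move by auto
  obtain \<sigma>2 where \<sigma>2: "explorer_strategy G \<sigma>2"
    "\<And>p. play_against G (x \<otimes> inv g) \<sigma>2 p \<Longrightarrow> k \<le> card (insert (x \<otimes> inv g) W \<union> range p)"
    using move by auto
  \<comment> \<open>A history of length one prompts \<open>g\<close>; later on its second entry
    tells how Director answered. If both targets coincide, \<open>\<sigma>1\<close> serves.\<close>
  define \<sigma> where "\<sigma> h = (if tl h = [] then g else if h ! 1 = x \<otimes> g then \<sigma>1 (tl h) else \<sigma>2 (tl h))" for h
  have "explorer_strategy G \<sigma>"
    using \<sigma>1(1) \<sigma>2(1) move(1) by (simp add: explorer_strategy_def \<sigma>_def)
  moreover have "k \<le> card (W \<union> range p)" if p: "play_against G x \<sigma> p" for p
  proof -
    let ?q = "p \<circ> Suc"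
    have p1: "p 1 = x \<otimes> g \<or> p 1 = x \<otimes> inv g"
    proof -
      have "\<sigma> (map p [0..<Suc 0]) = g" by (simp add: \<sigma>_def)
      then show ?thesis
        using p unfolding play_against_def Let_def by (metis One_nat_def)
    qed
    have q: "play_against G (p 1) (\<lambda>h. \<sigma> (x # h)) ?q"
      by (rule play_against_shift[OF p])
    have hd: "map ?q [0..<Suc n] ! 0 = p 1" for n
      by (simp del: upt_Suc)
    have fin: "finite (W \<union> range p)"
      using play_in_carrier[OF \<open>explorer_strategy G \<sigma>\<close> p] move.prems
      by (meson Un_least finite_subset image_subsetI)
    have sub: "insert (p 1) W \<union> range ?q \<subseteq> W \<union> range p"
      by auto
    have "k \<le> card (insert (p 1) W \<union> range ?q)"
    proof (cases "p 1 = x \<otimes> g")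
      case True
      then have "play_against G (x \<otimes> g) \<sigma>1 ?q"
        using q hd unfolding play_against_def Let_def \<sigma>_def by (simp del: upt_Suc)
      then show ?thesis unfolding True by (rule \<sigma>1(2))
    next
      case False
      then have eq: "p 1 = x \<otimes> inv g" using p1 by blast
      have "play_against G (x \<otimes> inv g) \<sigma>2 ?q"
        using q hd False eq unfolding play_against_def Let_def \<sigma>_def by (simp del: upt_Suc)
      then show ?thesis unfolding eq by (rule \<sigma>2(2))
    qed
    also have "\<dots> \<le> card (W \<union> range p)"
      by (rule card_mono[OF fin sub])
    finally show ?thesis .
  qed
  ultimately show ?case by blast
qed

text \<open>This is determinacy: if Explorer cannot force the goal, Director can stay among states
  where it cannot be forced. Against \<open>\<sigma>\<close> this yields an infinite play that
  visits fewer than \<open>k\<close> elements.\<close>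

lemma can_force_of_guarantees:
  assumes "explorer_guarantees G s k" "finite (carrier G)" "s \<in> carrier G"
  shows "can_force G (\<lambda>W _. k \<le> card W) {s} s"
proof (rule ccontr)
  let ?F = "can_force G (\<lambda>W _. k \<le> card W)"
  assume neg: "\<not> ?F {s} s"
  obtain \<sigma> where \<sigma>: "explorer_strategy G \<sigma>"
    "\<And>p. play_against G s \<sigma> p \<Longrightarrow> k \<le> card (range p)"
    using assms(1) unfolding explorer_guarantees_def by blast
  define nxt where "nxt h = (let y = last h \<otimes> \<sigma> h in
      if ?F (insert y (set h)) y then last h \<otimes> inv (\<sigma> h) else y)" for h
  define H where "H = rec_nat [s] (\<lambda>_ h. h @ [nxt h])"
  have H0: "H 0 = [s]" and HS: "H (Suc n) = H n @ [nxt (H n)]" for n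
    by (simp_all add: H_def)
  define p where "p n = last (H n)" for n
  have hist: "map p [0..<Suc n] = H n" for n
    by (induction n) (auto simp: p_def H0 HS)
  have play: "play_against G s \<sigma> p"
    unfolding play_against_def Let_def hist
    by (auto simp: p_def H0 HS nxt_def Let_def)
  \<comment> \<open>Director always answers with a move after which Explorer cannot force the goal.\<close>
  have unforced: "\<not> ?F (set (H n)) (last (H n))" for n
  proof (induction n)
    case 0
    then show ?case using neg by (simp add: H0)
  next
    case (Suc n)
    have "\<sigma> (H n) \<in> carrier G"
      using \<sigma>(1) by (simp add: explorer_strategy_def)
    then show ?case
      using Suc can_force.move[of "\<sigma> (H n)" G _ "last (H n)" "set (H n)"]
      by (auto simp: HS nxt_def Let_def)
  qed
  have "finite (range p)"
    using play_in_carrier[OF \<sigma>(1) play assms(3)] assms(2)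
    by (meson finite_subset image_subsetI)
  \<comment> \<open>The range is finite, so some \<open>H n\<close> already contains every position
    of the play.\<close>
  then obtain N where "finite N" "range p = p ` N"
    by (metis finite_subset_image subset_UNIV subset_refl)
  moreover obtain n where "N \<subseteq> {0..<Suc n}"
    using \<open>finite N\<close> by (metis atLeast0LessThan finite_nat_iff_bounded lessThan_Suc subset_insertI2)
  ultimately have "range p = p ` {0..<Suc n}"
    by (metis image_mono subset_antisym subset_UNIV)
  then have "range p = set (H n)"
    by (simp only: hist[symmetric] set_map set_upt)
  then show False
    using \<sigma>(2)[OF play] unforced[of n] can_force.goal by metis
qed

lemma explorer_guarantees_iff:
  assumes "finite (carrier G)" "s \<in> carrier G"
  shows "explorer_guarantees G s k \<longleftrightarrow> can_force G (\<lambda>W _. k \<le> card W) {s} s"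
proof
  assume "can_force G (\<lambda>W _. k \<le> card W) {s} s"
  from strategy_of_can_force[OF this] obtain \<sigma> where \<sigma>: "explorer_strategy G \<sigma>"
    "\<And>p. play_against G s \<sigma> p \<Longrightarrow> k \<le> card ({s} \<union> range p)"
    using assms by auto
  have "{s} \<union> range p = range p" if "play_against G s \<sigma> p" for p
    using that unfolding play_against_def by auto
  then show "explorer_guarantees G s k"
    unfolding explorer_guarantees_def using \<sigma> by metis
qed (use can_force_of_guarantees assms in blast)

text \<open>The guaranteed numbers contain \<open>0\<close> and are bounded by
  \<open>order G\<close>, so \<open>GREATEST\<close> is an attained maximum.\<close>

lemma
  assumes "finite (carrier G)" "s \<in> carrier G"
  shows explorer_guarantees_explorer_director: "explorer_guarantees G s (explorer_director G s)"
    and explorer_guarantees_le_explorer_director: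
      "explorer_guarantees G s k \<Longrightarrow> k \<le> explorer_director G s"
proof -
  have le: "k \<le> order G"
    if "can_force G (\<lambda>W _. k \<le> card W) W x" "W \<subseteq> carrier G" "x \<in> carrier G" for k W x
    using that
    by (induction rule: can_force.induct) (auto simp: order_def intro: le_trans card_mono assms(1))
  have bound: "k \<le> order G" if "explorer_guarantees G s k" for k
    using le[of k "{s}" s] can_force_of_guarantees[OF that] assms by simp
  have "explorer_guarantees G s 0"
    by (auto simp: explorer_guarantees_def explorer_strategy_def)
  then show "explorer_guarantees G s (explorer_director G s)"
    unfolding explorer_director_def using bound by (rule GreatestI_nat)
  show "k \<le> explorer_director G s" if "explorer_guarantees G s k"
    unfolding explorer_director_def using that bound by (rule Greatest_le_nat)
qed

section \<open>Forced displacements inside a coset\<close>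

text \<open>Induction on \<open>k\<close>: after the unwanted answer
  \<open>x \<otimes> inv c\<close>, the displacement \<open>c \<otimes> c\<close> still leads to
  \<open>x \<otimes> c\<close>. The condition on a power, in place of an exact order, passes to
  \<open>c \<otimes> c\<close> with \<open>k\<close> lowered by one.\<close>

lemma can_force_step_power_of_two:
  assumes "c [^] ((2::nat) ^ k) = \<one>" "c \<in> carrier G" "x \<in> carrier G" "W \<subseteq> carrier G"
  shows "can_force G (\<lambda>W' y. W \<subseteq> W' \<and> W' \<subseteq> carrier G \<and> y = x \<otimes> c \<and> y \<in> W') W x"
  using assms
proof (induction k arbitrary: c x W)
  case 0
  then have "c = \<one>" by simp
  show ?case
    \<comment> \<open>Naming \<open>\<one>\<close> leaves the token in place but records
      \<open>x\<close> as visited, which the goal demands and \<open>W\<close> need not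
      provide.\<close>
    by (rule can_force.move[OF one_closed]; rule can_force.goal) (use 0 \<open>c = \<one>\<close> in auto)
next
  case (Suc k)
  let ?y = "x \<otimes> inv c" and ?c2 = "c \<otimes> c"
  have "?c2 [^] ((2::nat) ^ k) = \<one>"
    using Suc.prems nat_pow_pow[of c 2 "2 ^ k"] by (simp add: numeral_2_eq_2)
  then have "can_force G (\<lambda>W' y. insert ?y W \<subseteq> W' \<and> W' \<subseteq> carrier G \<and> y = ?y \<otimes> ?c2 \<and> y \<in> W')
      (insert ?y W) ?y"
    using Suc.prems by (intro Suc.IH) auto
  moreover have "?y \<otimes> ?c2 = x \<otimes> c"
    using Suc.prems by (metis inv_closed inv_solve_right' m_assoc m_closed)
  ultimately have "can_force G (\<lambda>W' y. W \<subseteq> W' \<and> W' \<subseteq> carrier G \<and> y = x \<otimes> c \<and> y \<in> W')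
      (insert ?y W) ?y"
    by (elim can_force_mono) auto
  then show ?case
    by (rule can_force.move[OF \<open>c \<in> carrier G\<close>, rotated])
      (rule can_force.goal, use Suc.prems in auto)
qed

lemma two_power_subgroup_is_subgroup: "subgroup (two_power_subgroup G) G"
  unfolding two_power_subgroup_def by (rule generate_is_subgroup) auto

text \<open>Induction over the generation of \<open>c\<close>: generators and their inverses have
  2-power order, and for a product two forced displacements are made in succession.\<close>

lemma can_force_step:
  assumes "c \<in> two_power_subgroup G" "x \<in> carrier G" "W \<subseteq> carrier G"
  shows "can_force G (\<lambda>W' y. W \<subseteq> W' \<and> W' \<subseteq> carrier G \<and> y = x \<otimes> c \<and> y \<in> W') W x"
  using assms unfolding two_power_subgroup_def
proof (induction arbitrary: x W rule: generate.induct)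
  case one
  then show ?case by (intro can_force_step_power_of_two[of _ 0]) simp_all
next
  case (incl h)
  then obtain k :: nat where "ord h = 2 ^ k" "h \<in> carrier G" by auto
  then have "h [^] ((2::nat) ^ k) = \<one>" by (metis pow_ord_eq_1)
  then show ?case
    using \<open>h \<in> carrier G\<close> incl.prems by (rule can_force_step_power_of_two)
next
  case (inv h)
  then obtain k :: nat where "ord (inv h) = 2 ^ k" "h \<in> carrier G" by auto
  then have "inv h [^] ((2::nat) ^ k) = \<one>" by (metis inv_closed pow_ord_eq_1)
  then show ?case
    by (rule can_force_step_power_of_two) (use \<open>h \<in> carrier G\<close> inv.prems in simp_all)
next
  case (eng h1 h2)
  have h: "h1 \<in> carrier G" "h2 \<in> carrier G"
    by (rule generate_in_carrier[OF _ eng.hyps(1)], blast)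
      (rule generate_in_carrier[OF _ eng.hyps(2)], blast)
  show ?case
  proof (rule can_force_bind[OF eng.IH(1)[OF eng.prems]])
    fix W' y
    assume *: "W \<subseteq> W' \<and> W' \<subseteq> carrier G \<and> y = x \<otimes> h1 \<and> y \<in> W'"
    then have "y \<in> carrier G" "W' \<subseteq> carrier G" "y \<otimes> h2 = x \<otimes> (h1 \<otimes> h2)"
      using h eng.prems by (auto simp: m_assoc)
    with * show "can_force G (\<lambda>W' y. W \<subseteq> W' \<and> W' \<subseteq> carrier G \<and> y = x \<otimes> (h1 \<otimes> h2) \<and> y \<in> W') W' y"
      by (intro can_force_mono[OF eng.IH(2)[of y W']]) auto
  qed
qed

text \<open>The elements are visited one at a time. The clause on the final position keeps the token
  in the coset, so the next element is one forced displacement away.\<close>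

lemma can_force_subset_coset:
  assumes "finite C" "C \<subseteq> two_power_subgroup G" "x \<in> carrier G" "W \<subseteq> carrier G"
  shows "can_force G (\<lambda>W' y. W \<subseteq> W' \<and> W' \<subseteq> carrier G \<and> (\<forall>c\<in>C. x \<otimes> c \<in> W') \<and>
    (\<exists>c\<in>two_power_subgroup G. y = x \<otimes> c)) W x"
  using assms
proof (induction C rule: finite_induct)
  case empty
  have "\<one> \<in> two_power_subgroup G"
    using subgroup.one_closed two_power_subgroup_is_subgroup by blast
  then show ?case
    using empty by (intro can_force.goal) (auto intro: bexI[of _ \<one>])
next
  case (insert c C)
  let ?N = "two_power_subgroup G"
  interpret N: subgroup ?N G by (rule two_power_subgroup_is_subgroup)
  show ?case
  proof (rule can_force_bind[OF insert.IH])
    fix W' y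
    assume W': "W \<subseteq> W' \<and> W' \<subseteq> carrier G \<and> (\<forall>c\<in>C. x \<otimes> c \<in> W') \<and> (\<exists>c\<in>?N. y = x \<otimes> c)"
    then obtain b where b: "b \<in> ?N" "y = x \<otimes> b" by blast
    have c: "c \<in> ?N" using insert.prems by simp
    have "y \<otimes> (inv b \<otimes> c) = x \<otimes> c"
      using b c insert.prems by (simp add: m_assoc flip: m_assoc[of b])
    moreover have "can_force G (\<lambda>W'' z. W' \<subseteq> W'' \<and> W'' \<subseteq> carrier G \<and> z = y \<otimes> (inv b \<otimes> c) \<and> z \<in> W'') W' y"
      using b c insert.prems W' by (intro can_force_step) auto
    ultimately show "can_force G (\<lambda>W' y. W \<subseteq> W' \<and> W' \<subseteq> carrier G \<and>
        (\<forall>c\<in>insert c C. x \<otimes> c \<in> W') \<and> (\<exists>c\<in>?N. y = x \<otimes> c)) W' y"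
      using c W' by (elim can_force_mono) auto
  qed (use insert.prems in auto)
qed

section \<open>Normality and odd index\<close>

text \<open>Conjugation preserves orders, so it maps the generating set into itself.\<close>

lemma two_power_subgroup_normal: "two_power_subgroup G \<lhd> G"
  unfolding two_power_subgroup_def
proof (rule normal_generateI)
  fix h g
  assume h: "h \<in> {x \<in> carrier G. \<exists>k. ord x = 2 ^ k}" and g: "g \<in> carrier G"
  have pow: "(g \<otimes> h \<otimes> inv g) [^] n = g \<otimes> h [^] n \<otimes> inv g" for n :: nat
  proof (induction n)
    case (Suc n)
    then show ?case
      using g h by (simp add: m_assoc) (simp add: inv_solve_left m_assoc flip: m_assoc[of "inv g" g])
  qed (use g in simp)
  have "(g \<otimes> h \<otimes> inv g) [^] n = \<one> \<longleftrightarrow> h [^] n = \<one>" for n :: nat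
    using g h unfolding pow by (simp add: inv_solve_right')
  then have "ord (g \<otimes> h \<otimes> inv g) = ord h"
    using g h by (intro ord_unique[THEN iffD2] allI) (auto simp: pow_eq_id)
  with g h show "g \<otimes> h \<otimes> inv g \<in> {x \<in> carrier G. \<exists>k. ord x = 2 ^ k}" by auto
qed auto

lemma odd_order_mod_two_power_subgroup:
  assumes "finite (carrier G)"
  shows "odd (order (G Mod two_power_subgroup G))"
proof
  let ?N = "two_power_subgroup G"
  assume "even (order (G Mod ?N))"
  moreover have "order (G Mod ?N) * card ?N = order G"
    using lagrange[OF two_power_subgroup_is_subgroup] by (simp add: order_def FactGroup_def)
  moreover have "order G \<noteq> 0" "\<not> is_unit (2::nat)"
    using assms order_gt_0_iff_finite by auto
  then obtain a m where am: "order G = 2 ^ a * m" "odd m"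
    using multiplicity_decompose' by metis
  moreover obtain P where P: "subgroup P G" "card P = 2 ^ a"
    using sylow_thm[OF two_is_prime_nat is_group am(1) assms] by blast
  \<comment> \<open>Orders of elements of \<open>P\<close> divide \<open>2 ^ a\<close>, so these
    elements are generators of \<open>?N\<close>.\<close>
  moreover have "P \<subseteq> ?N"
  proof
    fix x assume x: "x \<in> P"
    interpret P: subgroup P G by (rule P)
    have "x [^] card P = \<one>"
      using group.pow_order_eq_1[OF P.subgroup_is_group[OF is_group], of x] x
      by (simp add: order_def flip: nat_pow_consistent)
    then have "ord x dvd 2 ^ a" using x P(2) by (simp add: pow_eq_id)
    then obtain k where "ord x = 2 ^ k"
      by (meson divides_primepow_nat two_is_prime_nat)
    then show "x \<in> ?N"
      unfolding two_power_subgroup_def using x by (auto intro: generate.incl)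
  qed
  then have "card P dvd card ?N"
    using group.lagrange[OF subgroup.subgroup_is_group[OF two_power_subgroup_is_subgroup is_group]
      subgroup_incl[OF P(1) two_power_subgroup_is_subgroup], symmetric]
    by (simp add: order_def)
  \<comment> \<open>The even index contributes a factor 2 and \<open>card ?N\<close> a factor
    \<open>2 ^ a\<close>, one factor 2 more than \<open>order G\<close> contains.\<close>
  ultimately have "2 * 2 ^ a dvd 2 ^ a * m"
    by (metis mult_dvd_mono)
  then show False using am(2) by (simp add: mult.commute)
qed

end

section \<open>Transfer of the game along a homomorphism\<close>

context group_hom
begin

text \<open>
  Homomorphisms are followed by a left translation by \<open>a\<close> so that one map handles both the
  quotient and the change of starting position.
\<close>

lemma can_force_hom_image:
  assumes "can_force G P W x" "a \<in> carrier H" "x \<in> carrier G" "W \<subseteq> carrier G"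
  shows "can_force H
    (\<lambda>V _. \<exists>W' y. P W' y \<and> W' \<subseteq> carrier G \<and> V = (\<lambda>z. a \<otimes>\<^bsub>H\<^esub> h z) ` W')
    ((\<lambda>z. a \<otimes>\<^bsub>H\<^esub> h z) ` W) (a \<otimes>\<^bsub>H\<^esub> h x)"
  using assms
proof (induction rule: can_force.induct)
  case (goal W x)
  then show ?case by (blast intro: can_force.goal)
next
  case (move g x W)
  show ?case
    by (rule can_force.move[of "h g"]) (use move in \<open>auto simp: H.m_assoc\<close>)
qed

text \<open>Translation by \<open>a\<close> is injective, so the fibres are those of
  \<open>h\<close>, namely left cosets of the kernel.\<close>

lemma card_translated_fibre:
  assumes "a \<in> carrier H" "x \<in> carrier G"
  shows "card {z \<in> carrier G. a \<otimes>\<^bsub>H\<^esub> h z = a \<otimes>\<^bsub>H\<^esub> h x} = card (kernel G H h)"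
    and "{z \<in> carrier G. a \<otimes>\<^bsub>H\<^esub> h z = a \<otimes>\<^bsub>H\<^esub> h x} = (\<otimes>) x ` kernel G H h"
proof -
  show eq: "{z \<in> carrier G. a \<otimes>\<^bsub>H\<^esub> h z = a \<otimes>\<^bsub>H\<^esub> h x} = (\<otimes>) x ` kernel G H h" (is "?L = ?R")
  proof
    show "?L \<subseteq> ?R"
    proof
      fix z assume "z \<in> ?L"
      then have "inv x \<otimes> z \<in> kernel G H h"
        using assms by (auto simp: kernel_def)
      moreover have "z = x \<otimes> (inv x \<otimes> z)"
        using assms \<open>z \<in> ?L\<close> by (simp flip: G.m_assoc)
      ultimately show "z \<in> ?R" by blast
    qed
  qed (use assms in \<open>auto simp: kernel_def\<close>)
  have "inj_on ((\<otimes>) x) (kernel G H h)"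
    using assms by (auto simp: inj_on_def kernel_def)
  then show "card ?L = card (kernel G H h)"
    unfolding eq by (rule card_image)
qed

lemma card_preimage:
  assumes "a \<in> carrier H" "finite (carrier G)" "V \<subseteq> (\<lambda>z. a \<otimes>\<^bsub>H\<^esub> h z) ` carrier G"
  shows "card {z \<in> carrier G. a \<otimes>\<^bsub>H\<^esub> h z \<in> V} = card V * card (kernel G H h)"
proof -
  let ?\<phi> = "\<lambda>z. a \<otimes>\<^bsub>H\<^esub> h z"
  have "{z \<in> carrier G. ?\<phi> z \<in> V} = (\<Union>v\<in>V. {z \<in> carrier G. ?\<phi> z = v})" by blast
  also have "card \<dots> = (\<Sum>v\<in>V. card {z \<in> carrier G. ?\<phi> z = v})"
    using assms finite_subset by (intro card_UN_disjoint) auto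
  also have "\<dots> = (\<Sum>v\<in>V. card (kernel G H h))"
    using assms card_translated_fibre(1) by (intro sum.cong) auto
  finally show ?thesis by simp
qed

text \<open>The fibre is a coset of \<open>two_power_subgroup G\<close>, which Explorer can exhaust;
  the image of the token is the same afterwards, so the play in \<open>H\<close> can resume.\<close>

lemma can_force_visit_fibre:
  assumes "finite (carrier G)" "kernel G H h = two_power_subgroup G"
    and "a \<in> carrier H" "x \<in> carrier G" "W \<subseteq> carrier G"
  shows "can_force G (\<lambda>W' y. W \<subseteq> W' \<and> W' \<subseteq> carrier G \<and> y \<in> carrier G \<and>
    a \<otimes>\<^bsub>H\<^esub> h y = a \<otimes>\<^bsub>H\<^esub> h x \<and>
    {z \<in> carrier G. a \<otimes>\<^bsub>H\<^esub> h z = a \<otimes>\<^bsub>H\<^esub> h x} \<subseteq> W') W x"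
proof -
  have "finite (kernel G H h)"
    using assms(1) by (auto simp: kernel_def)
  then have "can_force G (\<lambda>W' y. W \<subseteq> W' \<and> W' \<subseteq> carrier G \<and>
      (\<forall>c\<in>kernel G H h. x \<otimes> c \<in> W') \<and> (\<exists>c\<in>kernel G H h. y = x \<otimes> c)) W x"
    using G.can_force_subset_coset[of "kernel G H h" x W] assms by simp
  then show ?thesis
  proof (rule can_force_mono)
    fix W' y
    assume *: "W \<subseteq> W' \<and> W' \<subseteq> carrier G \<and>
      (\<forall>c\<in>kernel G H h. x \<otimes> c \<in> W') \<and> (\<exists>c\<in>kernel G H h. y = x \<otimes> c)"
    then have "y \<in> {z \<in> carrier G. a \<otimes>\<^bsub>H\<^esub> h z = a \<otimes>\<^bsub>H\<^esub> h x}"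
      unfolding card_translated_fibre(2)[OF assms(3,4)] by blast
    moreover have "{z \<in> carrier G. a \<otimes>\<^bsub>H\<^esub> h z = a \<otimes>\<^bsub>H\<^esub> h x} \<subseteq> W'"
      unfolding card_translated_fibre(2)[OF assms(3,4)] using * by blast
    ultimately show "W \<subseteq> W' \<and> W' \<subseteq> carrier G \<and> y \<in> carrier G \<and>
      a \<otimes>\<^bsub>H\<^esub> h y = a \<otimes>\<^bsub>H\<^esub> h x \<and>
      {z \<in> carrier G. a \<otimes>\<^bsub>H\<^esub> h z = a \<otimes>\<^bsub>H\<^esub> h x} \<subseteq> W'"
      using * by blast
  qed
qed

text \<open>The play in \<open>H\<close> is simulated with the invariant that \<open>W\<close>
  contains all preimages of \<open>V\<close>: each named element is lifted, and the fibre reached is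
  swept before the next move. At the goal, counting preimages gives the factor
  \<open>card (kernel G H h)\<close>.\<close>

lemma can_force_lift:
  assumes "can_force H (\<lambda>V _. k \<le> card V) V u"
    and fin: "finite (carrier G)" and ker: "kernel G H h = two_power_subgroup G"
    and surj: "h ` carrier G = carrier H" and a: "a \<in> carrier H"
    and "V \<subseteq> carrier H" "x \<in> carrier G" "u = a \<otimes>\<^bsub>H\<^esub> h x" "W \<subseteq> carrier G"
    and "{z \<in> carrier G. a \<otimes>\<^bsub>H\<^esub> h z \<in> V} \<subseteq> W"
  shows "can_force G (\<lambda>W _. k * card (kernel G H h) \<le> card W) W x"
  using assms(1,6-)
proof (induction arbitrary: x W rule: can_force.induct)
  case (goal V u)
  have "V \<subseteq> (\<lambda>z. a \<otimes>\<^bsub>H\<^esub> h z) ` carrier G"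
  proof
    fix v assume "v \<in> V"
    then have "v \<in> carrier H" using goal by blast
    then have "inv\<^bsub>H\<^esub> a \<otimes>\<^bsub>H\<^esub> v \<in> h ` carrier G"
      using a surj by simp
    moreover have "v = a \<otimes>\<^bsub>H\<^esub> (inv\<^bsub>H\<^esub> a \<otimes>\<^bsub>H\<^esub> v)"
      using a \<open>v \<in> carrier H\<close> by (simp flip: H.m_assoc)
    ultimately show "v \<in> (\<lambda>z. a \<otimes>\<^bsub>H\<^esub> h z) ` carrier G" by auto
  qed
  then have "card V * card (kernel G H h) = card {z \<in> carrier G. a \<otimes>\<^bsub>H\<^esub> h z \<in> V}"
    by (rule card_preimage[OF a fin, symmetric])
  also have "\<dots> \<le> card W"
    using goal.prems fin by (intro card_mono) (auto intro: finite_subset)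
  finally have "card V * card (kernel G H h) \<le> card W" .
  then show ?case
    using goal(1) by (meson can_force.goal le_trans mult_le_mono1)
next
  case (move g u V)
  have "g \<in> h ` carrier G"
    using surj move.hyps(1) by simp
  then obtain b where b: "b \<in> carrier G" "h b = g"
    by blast
  \<comment> \<open>Both answers are treated alike, with \<open>d\<close> being \<open>g\<close> or
    its inverse and the induction hypothesis a premise: sweep the new fibre, then continue from
    wherever the sweep ends.\<close>
  have step: "can_force G (\<lambda>W _. k * card (kernel G H h) \<le> card W) (insert (x \<otimes> c) W) (x \<otimes> c)"
    if c: "c \<in> carrier G" "h c = d" and d: "d \<in> carrier H" and
      IH: "\<And>x' W'. insert (u \<otimes>\<^bsub>H\<^esub> d) V \<subseteq> carrier H \<Longrightarrow> x' \<in> carrier G \<Longrightarrow>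
        u \<otimes>\<^bsub>H\<^esub> d = a \<otimes>\<^bsub>H\<^esub> h x' \<Longrightarrow> W' \<subseteq> carrier G \<Longrightarrow>
        {z \<in> carrier G. a \<otimes>\<^bsub>H\<^esub> h z \<in> insert (u \<otimes>\<^bsub>H\<^esub> d) V} \<subseteq> W' \<Longrightarrow>
        can_force G (\<lambda>W _. k * card (kernel G H h) \<le> card W) W' x'" for c d
  proof (rule can_force_bind[OF can_force_visit_fibre[OF fin ker a]])
    show "x \<otimes> c \<in> carrier G" "insert (x \<otimes> c) W \<subseteq> carrier G"
      using c move.prems by auto
    have ud: "u \<otimes>\<^bsub>H\<^esub> d = a \<otimes>\<^bsub>H\<^esub> h (x \<otimes> c)"
      using c d a move.prems by (simp add: H.m_assoc)
    fix W' y
    assume *: "insert (x \<otimes> c) W \<subseteq> W' \<and> W' \<subseteq> carrier G \<and> y \<in> carrier G \<and>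
      a \<otimes>\<^bsub>H\<^esub> h y = a \<otimes>\<^bsub>H\<^esub> h (x \<otimes> c) \<and>
      {z \<in> carrier G. a \<otimes>\<^bsub>H\<^esub> h z = a \<otimes>\<^bsub>H\<^esub> h (x \<otimes> c)} \<subseteq> W'"
    show "can_force G (\<lambda>W _. k * card (kernel G H h) \<le> card W) W' y"
    proof (rule IH)
      show "y \<in> carrier G" "W' \<subseteq> carrier G"
        using * by simp_all
      show "insert (u \<otimes>\<^bsub>H\<^esub> d) V \<subseteq> carrier H"
        using move.prems a d by simp
      show "u \<otimes>\<^bsub>H\<^esub> d = a \<otimes>\<^bsub>H\<^esub> h y"
        using * ud by simp
      show "{z \<in> carrier G. a \<otimes>\<^bsub>H\<^esub> h z \<in> insert (u \<otimes>\<^bsub>H\<^esub> d) V} \<subseteq> W'"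
        unfolding ud using * move.prems(5) by blast
    qed
  qed
  show ?case
  proof (rule can_force.move)
    show "b \<in> carrier G" by fact
    show "can_force G (\<lambda>W _. k * card (kernel G H h) \<le> card W) (insert (x \<otimes> b) W) (x \<otimes> b)"
      using b move by (intro step[of b g])
    show "can_force G (\<lambda>W _. k * card (kernel G H h) \<le> card W) (insert (x \<otimes> inv b) W) (x \<otimes> inv b)"
      using b move by (intro step[of "inv b" "inv\<^bsub>H\<^esub> g"]) auto
  qed
qed

lemma explorer_director_eq:
  assumes fin: "finite (carrier G)" and ker: "kernel G H h = two_power_subgroup G"
    and surj: "h ` carrier G = carrier H" and s: "s \<in> carrier G" and t: "t \<in> carrier H"
  shows "explorer_director G s = explorer_director H t * card (kernel G H h)"
proof (rule antisym)
  let ?n = "card (kernel G H h)"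
  \<comment> \<open>Translation by \<open>a\<close> carries \<open>h s\<close> to \<open>t\<close>,
    which allows arbitrary starting positions.\<close>
  define a where "a = t \<otimes>\<^bsub>H\<^esub> inv\<^bsub>H\<^esub> h s"
  let ?\<phi> = "\<lambda>z. a \<otimes>\<^bsub>H\<^esub> h z"
  have a: "a \<in> carrier H" and at: "?\<phi> s = t"
    using s t by (auto simp: a_def H.m_assoc)
  have finH: "finite (carrier H)"
    using fin surj by (metis finite_imageI)
  have n: "0 < ?n"
    using fin card_gt_0_iff[of "kernel G H h"] by (auto simp: kernel_def)

  \<comment> \<open>\<open>?m\<close> is \<open>?F\<close> divided by \<open>?n\<close>, rounded up:
    \<open>?F\<close> elements cannot fit into fewer fibres of size \<open>?n\<close>.\<close>
  let ?F = "explorer_director G s" and ?m = "(explorer_director G s + ?n - 1) div ?n"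
  have "can_force G (\<lambda>W _. ?F \<le> card W) {s} s"
    using G.explorer_guarantees_explorer_director G.explorer_guarantees_iff fin s by blast
  from can_force_hom_image[OF this a s]
  have "can_force H (\<lambda>V _. \<exists>W'. ?F \<le> card W' \<and> W' \<subseteq> carrier G \<and> V = ?\<phi> ` W') {t} t"
    using s at by simp
  then have "can_force H (\<lambda>V _. ?m \<le> card V) {t} t"
  proof (rule can_force_mono)
    fix V
    assume "\<exists>W'. ?F \<le> card W' \<and> W' \<subseteq> carrier G \<and> V = ?\<phi> ` W'"
    then obtain W' where W': "?F \<le> card W'" "W' \<subseteq> carrier G" "V = ?\<phi> ` W'" by blast
    have "card W' \<le> card {z \<in> carrier G. ?\<phi> z \<in> V}"
      using W' fin by (intro card_mono) auto
    also have "\<dots> = card V * ?n"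
      using W' by (intro card_preimage a fin) auto
    finally have "?F \<le> card V * ?n" using W' by simp
    then have "?F + ?n - 1 < (card V + 1) * ?n"
      using n by simp
    then show "?m \<le> card V"
      using n by (metis Suc_eq_plus1 div_less_iff_less_mult less_Suc_eq_le)
  qed
  then have "?m \<le> explorer_director H t"
    using H.explorer_guarantees_le_explorer_director H.explorer_guarantees_iff finH t by blast
  then have "?F + ?n - 1 < (explorer_director H t + 1) * ?n"
    using n by (metis Suc_eq_plus1 div_less_iff_less_mult less_Suc_eq_le)
  then show "?F \<le> explorer_director H t * ?n"
    by simp

  have H: "can_force H (\<lambda>V _. explorer_director H t \<le> card V) {t} t"
    using H.explorer_guarantees_explorer_director H.explorer_guarantees_iff finH t by blast
  \<comment> \<open>Sweeping the fibre of \<open>s\<close> first establishes the invariant of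
    \<open>can_force_lift\<close> for \<open>V = {t}\<close>.\<close>
  have "can_force G (\<lambda>W _. explorer_director H t * ?n \<le> card W) {s} s"
  proof (rule can_force_bind[OF can_force_visit_fibre[OF fin ker a s]])
    fix W y
    assume "{s} \<subseteq> W \<and> W \<subseteq> carrier G \<and> y \<in> carrier G \<and> ?\<phi> y = ?\<phi> s \<and>
      {z \<in> carrier G. ?\<phi> z = ?\<phi> s} \<subseteq> W"
    then show "can_force G (\<lambda>W _. explorer_director H t * ?n \<le> card W) W y"
      using at t by (intro can_force_lift[OF H fin ker surj a]) auto
  qed (use s in auto)
  then show "explorer_director H t * ?n \<le> ?F"
    using G.explorer_guarantees_le_explorer_director G.explorer_guarantees_iff fin s by blast
qed

end

section \<open>The canonical projection onto the quotient\<close>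

theorem theorem1p4:
  fixes G :: "('a, 'b) monoid_scheme"
  assumes "group G" and "finite (carrier G)"
  shows "two_power_subgroup G \<lhd> G
    \<and> odd (order (G Mod two_power_subgroup G))
    \<and> (\<forall>s \<in> carrier G. \<forall>t \<in> carrier (G Mod two_power_subgroup G).
          explorer_director G s
            = explorer_director (G Mod two_power_subgroup G) t * card (two_power_subgroup G))"
proof -
  interpret group G by fact
  let ?N = "two_power_subgroup G"
  interpret N: normal ?N G by (rule two_power_subgroup_normal)
  interpret Q: group_hom G "G Mod ?N" "\<lambda>x. ?N #>\<^bsub>G\<^esub> x"
    using N.r_coset_hom_Mod N.factorgroup_is_group is_group
    by (simp add: group_hom_def group_hom_axioms_def)
  have ker: "kernel G (G Mod ?N) (\<lambda>x. ?N #>\<^bsub>G\<^esub> x) = ?N"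
    using coset_join1[of ?N] coset_join2[of _ ?N] N.subset N.subgroup_axioms
    by (auto simp: kernel_def)
  have surj: "(\<lambda>x. ?N #>\<^bsub>G\<^esub> x) ` carrier G = carrier (G Mod ?N)"
    by (auto simp: FactGroup_def RCOSETS_def)
  show ?thesis
    using two_power_subgroup_normal odd_order_mod_two_power_subgroup[OF assms(2)]
      Q.explorer_director_eq[OF assms(2) ker surj] ker by simp
qed

end
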